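(* Let $R$ be a commutative ring and let $\mathcal{C}=((J_0,U_0),\ldots,(J_\ell,U_\ell))$ be an idealistic chain in $R$. (1) Let $x\in R$ and $i\in\{0,\ldots,\ell\}$. Suppose that the idealistic chains $\mathcal{C}\,\&\,\{x\in\mathcal{C}^{(i)}\}$ and $\mathcal{C}\,\&\,\{x\notin\mathcal{C}^{(i)}\}$ both collapse. Then $\mathcal{C}$ collapses. (2) The idealistic chain $\mathcal{C}$ generates a minimum saturated idealistic chain (i.e. there is a least saturated idealistic chain refining $\mathcal{C}$, for the refinement relation $\le$). It is obtained by adding to $U_i$ (resp. to $J_i$), for each $i$, all the elements $x\in R$ such that the idealistic chain $\mathcal{C}\,\&\,\{x\in\mathcal{C}^{(i)}\}$ (resp. $\mathcal{C}\,\&\,\{x\notin\mathcal{C}^{(i)}\}$) collapses.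
   Context: For $J,U\subseteq R$, $\langle J\rangle$ is the ideal of $R$ generated by $J$ and $\mathcal{M}(U)$ is the multiplicative submonoid (containing $1$) generated by $U$. An idealistic prime in $R$ is a pair $(J,U)$ of subsets of $R$. An idealistic chain of length $\ell$ is a list of $\ell+1$ idealistic primes $\mathcal{C}=((J_0,U_0),\ldots,(J_\ell,U_\ell))$. The chain $\mathcal{C}'=((J'_0,U'_0),\ldots,(J'_\ell,U'_\ell))$ is a refinement of $\mathcal{C}$, written $\mathcal{C}\le\mathcal{C}'$, if $J_i\subseteq J'_i$ and $U_i\subseteq U'_i$ for all $i$. $\mathcal{C}\,\&\,\{x\in\mathcal{C}^{(i)}\}$ denotes the chain obtained from $\mathcal{C}$ by replacing $J_i$ by $J_i\cup\{x\}$; $\mathcal{C}\,\&\,\{x\notin\mathcal{C}^{(i)}\}$ denotes the chain obtained by replacing $U_i$ by $U_i\cup\{x\}$. The chain $\mathcal{C}$ collapses if there exist $j_i\in\langle J_i\rangle$ and $u_i\in\mathcal{M}(U_i)$ $(i=0,\ldots,\ell)$ with $$u_0\cdot(u_1\cdot(\cdots(u_\ell+j_\ell)+\cdots)+j_1)+j_0=0.$$ An idealistic prime $(I,S)$ is complete if $I$ is an ideal, $S$ is a multiplicative monoid and $I+S=S$. A chain is complete if all its $(J_i,U_i)$ are complete and $J_i\subseteq J_{i+1}$, $U_{i+1}\subseteq U_i$ for $0\le i<\ell$. An ideal $I$ and a monoid $S$ are conjugate if: ($sa\in I$, $s\in S$ imply $a\in I$); ($a^n\in I$, $n>0$ imply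 $a\in I$); ($j\in I$, $s\in S$ imply $s+j\in S$); ($s_1s_2\in S$ implies $s_1\in S$). A chain is saturated if it is complete and, for each $i$, $J_i$ and $U_i$ are conjugate. *)

theory Defs
  imports "HOL-Algebra.Ideal"
begin

type_synonym 'a idealistic_prime = "'a set \<times> 'a set"

type_synonym 'a idealistic_chain = "'a idealistic_prime list"

definition idealistic_prime :: "('a, 'b) ring_scheme \<Rightarrow> 'a idealistic_prime \<Rightarrow> bool" where
  "idealistic_prime R P \<longleftrightarrow> fst P \<subseteq> carrier R \<and> snd P \<subseteq> carrier R"

definition idealistic_chain ::
  "('a, 'b) ring_scheme \<Rightarrow> nat \<Rightarrow> 'a idealistic_chain \<Rightarrow> bool" where
  "idealistic_chain R l C \<longleftrightarrow> length C = Suc l \<and> (\<forall>P \<in> set C. idealistic_prime R P)"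

abbreviation chain_J :: "'a idealistic_chain \<Rightarrow> nat \<Rightarrow> 'a set" where
  "chain_J C i \<equiv> fst (C ! i)"

abbreviation chain_U :: "'a idealistic_chain \<Rightarrow> nat \<Rightarrow> 'a set" where
  "chain_U C i \<equiv> snd (C ! i)"

text \<open>Chains of different lengths are unrelated by refinement.\<close>

definition refines :: "'a idealistic_chain \<Rightarrow> 'a idealistic_chain \<Rightarrow> bool" where
  "refines C C' \<longleftrightarrow>
     length C = length C' \<and>
     (\<forall>i < length C. chain_J C i \<subseteq> chain_J C' i \<and> chain_U C i \<subseteq> chain_U C' i)"

definition add_in :: "'a idealistic_chain \<Rightarrow> nat \<Rightarrow> 'a \<Rightarrow> 'a idealistic_chain" where
  "add_in C i x = C[i := (chain_J C i \<union> {x}, chain_U C i)]"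

definition add_notin :: "'a idealistic_chain \<Rightarrow> nat \<Rightarrow> 'a \<Rightarrow> 'a idealistic_chain" where
  "add_notin C i x = C[i := (chain_J C i, chain_U C i \<union> {x})]"

text \<open>As for \<open>genideal\<close>, this is meaningful only for \<open>U \<subseteq> carrier R\<close>.\<close>

definition genmonoid :: "('a, 'b) ring_scheme \<Rightarrow> 'a set \<Rightarrow> 'a set" where
  "genmonoid R U = \<Inter>{S. submonoid S R \<and> U \<subseteq> S}"

text \<open>
  \<open>nested R u j i k\<close> is
  \<open>u\<^sub>i \<cdot> (u\<^sub>i\<^sub>+\<^sub>1 \<cdot> (\<dots> (u\<^sub>i\<^sub>+\<^sub>k + j\<^sub>i\<^sub>+\<^sub>k) + \<dots>) + j\<^sub>i\<^sub>+\<^sub>1) + j\<^sub>i\<close>.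
\<close>

primrec nested ::
  "('a, 'b) ring_scheme \<Rightarrow> (nat \<Rightarrow> 'a) \<Rightarrow> (nat \<Rightarrow> 'a) \<Rightarrow> nat \<Rightarrow> nat \<Rightarrow> 'a" where
  "nested R u j i 0 = u i \<oplus>\<^bsub>R\<^esub> j i"
| "nested R u j i (Suc k) = (u i \<otimes>\<^bsub>R\<^esub> nested R u j (Suc i) k) \<oplus>\<^bsub>R\<^esub> j i"

definition collapses :: "('a, 'b) ring_scheme \<Rightarrow> nat \<Rightarrow> 'a idealistic_chain \<Rightarrow> bool" where
  "collapses R l C \<longleftrightarrow>
     (\<exists>u j. (\<forall>i \<le> l. j i \<in> Idl\<^bsub>R\<^esub> (chain_J C i) \<and> u i \<in> genmonoid R (chain_U C i)) \<and>
            nested R u j 0 l = \<zero>\<^bsub>R\<^esub>)"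

definition complete_prime :: "('a, 'b) ring_scheme \<Rightarrow> 'a idealistic_prime \<Rightarrow> bool" where
  "complete_prime R P \<longleftrightarrow>
     ideal (fst P) R \<and> submonoid (snd P) R \<and> fst P <+>\<^bsub>R\<^esub> snd P = snd P"

definition complete_chain ::
  "('a, 'b) ring_scheme \<Rightarrow> nat \<Rightarrow> 'a idealistic_chain \<Rightarrow> bool" where
  "complete_chain R l C \<longleftrightarrow>
     idealistic_chain R l C \<and>
     (\<forall>i \<le> l. complete_prime R (C ! i)) \<and>
     (\<forall>i < l. chain_J C i \<subseteq> chain_J C (Suc i) \<and> chain_U C (Suc i) \<subseteq> chain_U C i)"

definition conjugate_pair :: "('a, 'b) ring_scheme \<Rightarrow> 'a set \<Rightarrow> 'a set \<Rightarrow> bool" where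
  "conjugate_pair R I S \<longleftrightarrow>
     ideal I R \<and> submonoid S R \<and>
     (\<forall>s \<in> S. \<forall>a \<in> carrier R. s \<otimes>\<^bsub>R\<^esub> a \<in> I \<longrightarrow> a \<in> I) \<and>
     (\<forall>a \<in> carrier R. \<forall>n::nat. n > 0 \<longrightarrow> a [^]\<^bsub>R\<^esub> n \<in> I \<longrightarrow> a \<in> I) \<and>
     (\<forall>j \<in> I. \<forall>s \<in> S. s \<oplus>\<^bsub>R\<^esub> j \<in> S) \<and>
     (\<forall>s1 \<in> carrier R. \<forall>s2 \<in> carrier R. s1 \<otimes>\<^bsub>R\<^esub> s2 \<in> S \<longrightarrow> s1 \<in> S)"

definition saturated_chain ::
  "('a, 'b) ring_scheme \<Rightarrow> nat \<Rightarrow> 'a idealistic_chain \<Rightarrow> bool" where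
  "saturated_chain R l C \<longleftrightarrow>
     complete_chain R l C \<and> (\<forall>i \<le> l. conjugate_pair R (chain_J C i) (chain_U C i))"

definition least_saturated_refinement ::
  "('a, 'b) ring_scheme \<Rightarrow> nat \<Rightarrow> 'a idealistic_chain \<Rightarrow> 'a idealistic_chain \<Rightarrow> bool" where
  "least_saturated_refinement R l C D \<longleftrightarrow>
     saturated_chain R l D \<and> refines C D \<and>
     (\<forall>D'. saturated_chain R l D' \<and> refines C D' \<longrightarrow> refines D D')"

text \<open>
  The roles cross over: \<open>x\<close> joins \<open>J\<^sub>i\<close> when forcing \<open>x\<close> into \<open>U\<^sub>i\<close> makes the chain collapse,
  and conversely.
\<close>

definition collapse_closure ::
  "('a, 'b) ring_scheme \<Rightarrow> nat \<Rightarrow> 'a idealistic_chain \<Rightarrow> 'a idealistic_chain" where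
  "collapse_closure R l C =
     map (\<lambda>i. (chain_J C i \<union> {x \<in> carrier R. collapses R l (add_notin C i x)},
               chain_U C i \<union> {x \<in> carrier R. collapses R l (add_in C i x)}))
       [0..<Suc l]"

end

theory Submission
  imports "HOL-Algebra.Ring_Divisibility" Defs
begin

text \<open>
  The argument is a formal Nullstellensatz: a chain collapses iff there is no increasing chain of
  prime ideals \<open>P\<^sub>0 \<subseteq> \<dots> \<subseteq> P\<^sub>l\<close> with \<open>J\<^sub>i \<subseteq> P\<^sub>i\<close> and \<open>U\<^sub>i \<inter> P\<^sub>i = \<emptyset>\<close>. The values
  \<open>u\<^sub>i \<cdot> (\<dots> (u\<^sub>l + j\<^sub>l) \<dots>) + j\<^sub>i\<close> form a monoid \<open>S\<^sub>i\<close> with \<open>S\<^sub>i = U\<^sub>i S\<^sub>i\<^sub>+\<^sub>1 + J\<^sub>i\<close>; if \<open>0 \<notin> S\<^sub>0\<close>,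
  one picks successively \<open>P\<^sub>i\<close> containing \<open>J\<^sub>i + P\<^sub>i\<^sub>-\<^sub>1\<close> and disjoint from \<open>U\<^sub>i S\<^sub>i\<^sub>+\<^sub>1\<close>.
  Part (1) follows since \<open>x \<in> P\<^sub>i\<close> or \<open>x \<notin> P\<^sub>i\<close>; in part (2) the closure consists of the
  intersections of the \<open>P\<^sub>i\<close> and of the complements of their unions, which is visibly saturated.
  Minimality is a direct computation with the collapse identity in a saturated chain.
\<close>

section \<open>Prime ideals avoiding a monoid\<close>

lemma (in cring) ideal_sum_memI:
  assumes "ideal I R" "ideal J R"
  shows "I \<subseteq> I <+> J" "J \<subseteq> I <+> J"
proof -
  interpret I: ideal I R by fact
  interpret J: ideal J R by fact
  show "I \<subseteq> I <+> J"
  proof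
    fix x assume "x \<in> I"
    then have "x = x \<oplus> \<zero>" by (simp add: I.Icarr)
    then show "x \<in> I <+> J" using \<open>x \<in> I\<close> J.zero_closed unfolding set_add_def' by blast
  qed
  show "J \<subseteq> I <+> J"
  proof
    fix x assume "x \<in> J"
    then have "x = \<zero> \<oplus> x" by (simp add: J.Icarr)
    then show "x \<in> I <+> J" using \<open>x \<in> J\<close> I.zero_closed unfolding set_add_def' by blast
  qed
qed

text \<open>Zorn's lemma yields an ideal maximal among those that contain \<open>I\<close> and avoid
  \<open>S\<close>. It is prime: if \<open>a\<close> and \<open>b\<close> were outside it but
  \<open>a \<otimes> b\<close> inside, two elements of \<open>S\<close> would have their product in
  it.\<close>

lemma (in cring) prime_avoidance:
  assumes I: "ideal I R" and S: "submonoid S R" and disj: "I \<inter> S = {}"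
  obtains P where "primeideal P R" "I \<subseteq> P" "P \<inter> S = {}"
proof -
  let ?A = "{Q. ideal Q R \<and> I \<subseteq> Q \<and> Q \<inter> S = {}}"
  have "\<exists>M\<in>?A. \<forall>X\<in>?A. M \<subseteq> X \<longrightarrow> X = M"
  proof (rule subset_Zorn_nonempty)
    show "?A \<noteq> {}" using I disj by auto
    fix K assume ne: "K \<noteq> {}" and K: "subset.chain ?A K"
    then have "subset.chain {Q. ideal Q R} K" "K \<subseteq> ?A"
      by (auto simp: pred_on.chain_def)
    then show "\<Union>K \<in> ?A"
      using chain_Union_is_ideal[of K] ne by auto
  qed
  then obtain P where P: "ideal P R" "I \<subseteq> P" "P \<inter> S = {}"
    and max: "\<And>X. ideal X R \<Longrightarrow> P \<subseteq> X \<Longrightarrow> X \<inter> S = {} \<Longrightarrow> X = P"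
    by (smt (verit) mem_Collect_eq order_trans)
  interpret P: ideal P R by fact
  interpret S: submonoid S R by fact
  \<comment> \<open>Adjoining \<open>a\<close> to \<open>P\<close> enlarges it strictly, so by
    maximality the larger ideal must meet \<open>S\<close>.\<close>
  have meet: "\<exists>p\<in>P. \<exists>r\<in>carrier R. p \<oplus> r \<otimes> a \<in> S" if a: "a \<in> carrier R" "a \<notin> P" for a
  proof -
    have *: "ideal (P <+> PIdl a) R" "P \<subseteq> P <+> PIdl a" "a \<in> P <+> PIdl a"
      using a add_ideals P(1) cgenideal_ideal ideal_sum_memI[of P "PIdl a"] cgenideal_self by auto
    then have "(P <+> PIdl a) \<inter> S \<noteq> {}" using max a by blast
    then show ?thesis by (auto simp: set_add_def' cgenideal_def)
  qed
  have "primeideal P R"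
  proof (rule primeidealI[OF P(1) is_cring])
    show "carrier R \<noteq> P" using P(3) S.one_closed by auto
    fix a b assume ab: "a \<in> carrier R" "b \<in> carrier R" "a \<otimes> b \<in> P"
    show "a \<in> P \<or> b \<in> P"
    proof (rule ccontr)
      assume "\<not> (a \<in> P \<or> b \<in> P)"
      with meet ab obtain p r q t where
        *: "p \<in> P" "r \<in> carrier R" "p \<oplus> r \<otimes> a \<in> S" "q \<in> P" "t \<in> carrier R" "q \<oplus> t \<otimes> b \<in> S"
        by metis
      \<comment> \<open>Each summand of the expansion has a factor \<open>p\<close>,
        \<open>q\<close> or \<open>a \<otimes> b\<close> in \<open>P\<close>, whereas the product
        itself lies in \<open>S\<close>.\<close>
      have "(p \<oplus> r \<otimes> a) \<otimes> (q \<oplus> t \<otimes> b) =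
          p \<otimes> (q \<oplus> t \<otimes> b) \<oplus> ((r \<otimes> a) \<otimes> q \<oplus> (r \<otimes> t) \<otimes> (a \<otimes> b))"
        using * ab P.Icarr by algebra
      also have "\<dots> \<in> P"
        using * ab P.Icarr by (simp add: P.I_l_closed P.I_r_closed)
      finally show False using * P(3) S.m_closed by blast
    qed
  qed
  with P that show thesis by blast
qed

text \<open>Moving \<open>a\<close> to the other side turns \<open>disj\<close> into disjointness of
  \<open>N\<close> from the ideal \<open>A <+> I\<close>. The form \<open>n \<oplus> a\<close> is
  the one in which nested values arise.\<close>

lemma (in cring) prime_separation:
  assumes A: "ideal A R" and I: "ideal I R" and N: "submonoid N R"
    and disj: "\<And>n a. n \<in> N \<Longrightarrow> a \<in> A \<Longrightarrow> n \<oplus> a \<notin> I"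
  obtains Q where "primeideal Q R" "A \<subseteq> Q" "I \<subseteq> Q" "Q \<inter> N = {}"
proof -
  interpret A: ideal A R by fact
  interpret I: ideal I R by fact
  have "(A <+> I) \<inter> N = {}"
  proof (rule ccontr)
    assume "(A <+> I) \<inter> N \<noteq> {}"
    then obtain a x where *: "a \<in> A" "x \<in> I" "a \<oplus> x \<in> N" by (auto simp: set_add_def')
    have "(a \<oplus> x) \<oplus> \<ominus> a = x"
      using * A.Icarr I.Icarr by algebra
    then show False using disj[OF *(3), of "\<ominus> a"] * by auto
  qed
  from prime_avoidance[OF add_ideals[OF A I] N this] ideal_sum_memI[OF A I] that
  show thesis by (metis order_trans)
qed

section \<open>Nested values and the chains of primes they produce\<close>

definition nested_values ::
  "('a, 'b) ring_scheme \<Rightarrow> (nat \<Rightarrow> 'a set) \<Rightarrow> (nat \<Rightarrow> 'a set) \<Rightarrow> nat \<Rightarrow> nat \<Rightarrow> 'a set" where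
  "nested_values R M A i k =
     {nested R u j i k | u j. \<forall>m \<in> {i..i+k}. u m \<in> M m \<and> j m \<in> A m}"

lemma nested_cong:
  "(\<And>m. m \<in> {i..i+k} \<Longrightarrow> u m = u' m \<and> j m = j' m) \<Longrightarrow> nested R u j i k = nested R u' j' i k"
proof (induction k arbitrary: i)
  case (Suc k)
  have "nested R u j (Suc i) k = nested R u' j' (Suc i) k"
    by (rule Suc.IH) (use Suc.prems in auto)
  then show ?case using Suc.prems[of i] by simp
qed simp

lemma nested_values_0:
  "nested_values R M A i 0 = {u \<oplus>\<^bsub>R\<^esub> a | u a. u \<in> M i \<and> a \<in> A i}"
proof -
  have "u \<oplus>\<^bsub>R\<^esub> a \<in> nested_values R M A i 0" if "u \<in> M i" "a \<in> A i" for u a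
    unfolding nested_values_def using that
    by (intro CollectI exI[of _ "\<lambda>_. u"] exI[of _ "\<lambda>_. a"]) auto
  then show ?thesis by (auto simp: nested_values_def)
qed

text \<open>This is the recursion for the monoids \<open>S\<^sub>i\<close>. It trades the choice
  functions \<open>u\<close> and \<open>j\<close> for sets, so that the later inductions handle one
  level at a time.\<close>

lemma nested_values_Suc:
  "nested_values R M A i (Suc k) =
     {u \<otimes>\<^bsub>R\<^esub> s \<oplus>\<^bsub>R\<^esub> a | u s a. u \<in> M i \<and> s \<in> nested_values R M A (Suc i) k \<and> a \<in> A i}"
  (is "?L = ?R")
proof
  show "?L \<subseteq> ?R" by (fastforce simp: nested_values_def)
  show "?R \<subseteq> ?L"
  proof
    fix x assume "x \<in> ?R"
    then obtain v a u j where x: "x = v \<otimes>\<^bsub>R\<^esub> nested R u j (Suc i) k \<oplus>\<^bsub>R\<^esub> a" "v \<in> M i" "a \<in> A i"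
      and uj: "\<forall>m \<in> {Suc i..Suc i+k}. u m \<in> M m \<and> j m \<in> A m"
      by (auto simp: nested_values_def)
    \<comment> \<open>The inner expression starts at \<open>Suc i\<close>, so the functions may be
      overwritten at \<open>i\<close> to carry the new outer coefficients.\<close>
    have "nested R u j (Suc i) k = nested R (u(i := v)) (j(i := a)) (Suc i) k"
      by (rule nested_cong) auto
    then have "x = nested R (u(i := v)) (j(i := a)) i (Suc k)"
      using x by simp
    moreover have "\<forall>m \<in> {i..i + Suc k}. (u(i := v)) m \<in> M m \<and> (j(i := a)) m \<in> A m"
      using x uj by auto
    ultimately show "x \<in> ?L" unfolding nested_values_def by blast
  qed
qed

lemma (in cring) submonoid_mult:
  assumes "submonoid S R" "submonoid T R"
  shows "submonoid {s \<otimes> t | s t. s \<in> S \<and> t \<in> T} R"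
proof -
  interpret S: submonoid S R by fact
  interpret T: submonoid T R by fact
  show ?thesis
  proof
    fix x y assume "x \<in> {s \<otimes> t | s t. s \<in> S \<and> t \<in> T}" "y \<in> {s \<otimes> t | s t. s \<in> S \<and> t \<in> T}"
    then obtain s t s' t' where *: "x = s \<otimes> t" "y = s' \<otimes> t'" "s \<in> S" "t \<in> T" "s' \<in> S" "t' \<in> T"
      by auto
    then have "x \<otimes> y = (s \<otimes> s') \<otimes> (t \<otimes> t')"
      using S.mem_carrier T.mem_carrier by (simp add: m_ac)
    then show "x \<otimes> y \<in> {s \<otimes> t | s t. s \<in> S \<and> t \<in> T}" using * by blast
  qed (auto, metis S.one_closed T.one_closed l_one one_closed)
qed

lemma (in cring) submonoid_plus_ideal:
  assumes "submonoid S R" "ideal A R"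
  shows "submonoid {s \<oplus> a | s a. s \<in> S \<and> a \<in> A} R"
proof -
  interpret S: submonoid S R by fact
  interpret A: ideal A R by fact
  show ?thesis
  proof
    fix x y assume "x \<in> {s \<oplus> a | s a. s \<in> S \<and> a \<in> A}" "y \<in> {s \<oplus> a | s a. s \<in> S \<and> a \<in> A}"
    then obtain s a t b where *: "x = s \<oplus> a" "y = t \<oplus> b" "s \<in> S" "a \<in> A" "t \<in> S" "b \<in> A"
      by auto
    then have c: "s \<in> carrier R" "t \<in> carrier R" "a \<in> carrier R" "b \<in> carrier R"
      using A.Icarr by auto
    have "x \<otimes> y = (s \<otimes> t) \<oplus> (s \<otimes> b \<oplus> a \<otimes> (t \<oplus> b))"
      unfolding * using c by algebra
    moreover have "s \<otimes> b \<oplus> a \<otimes> (t \<oplus> b) \<in> A"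
      using * c by (intro A.a_closed A.I_l_closed A.I_r_closed) auto
    ultimately show "x \<otimes> y \<in> {s \<oplus> a | s a. s \<in> S \<and> a \<in> A}" using * by blast
  qed (use A.Icarr in auto, metis S.one_closed A.zero_closed r_zero one_closed)
qed

lemma (in cring) nested_values_submonoid:
  assumes "\<And>m. m \<in> {i..i+k} \<Longrightarrow> ideal (A m) R \<and> submonoid (M m) R"
  shows "submonoid (nested_values R M A i k) R"
  using assms
proof (induction k arbitrary: i)
  case 0
  then show ?case by (auto simp: nested_values_0 intro!: submonoid_plus_ideal)
next
  case (Suc k)
  have "submonoid (nested_values R M A (Suc i) k) R"
    by (rule Suc.IH) (use Suc.prems in auto)
  from submonoid_plus_ideal[OF submonoid_mult[OF _ this, of "M i"], of "A i"] Suc.prems[of i]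
  have "submonoid {n \<oplus> a | n a.
      n \<in> {s \<otimes> t | s t. s \<in> M i \<and> t \<in> nested_values R M A (Suc i) k} \<and> a \<in> A i} R"
    by auto
  also have "{n \<oplus> a | n a.
      n \<in> {s \<otimes> t | s t. s \<in> M i \<and> t \<in> nested_values R M A (Suc i) k} \<and> a \<in> A i} =
      nested_values R M A i (Suc k)"
    unfolding nested_values_Suc by blast
  finally show ?case .
qed

text \<open>The primes are chosen from level \<open>i\<close> upwards. The ideal \<open>I\<close> is
  generalized in the induction because it carries the prime chosen one level below, and
  \<open>I \<subseteq> P i\<close> is then what makes the chain increasing.\<close>

lemma (in cring) prime_chain_exists:
  assumes "\<And>m. m \<in> {i..i+k} \<Longrightarrow> ideal (A m) R \<and> submonoid (M m) R"
    and "ideal I R" and "I \<inter> nested_values R M A i k = {}"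
  shows "\<exists>P. I \<subseteq> P i \<and>
    (\<forall>m\<in>{i..i+k}. primeideal (P m) R \<and> A m \<subseteq> P m \<and> M m \<inter> P m = {}) \<and>
    (\<forall>m\<in>{i..<i+k}. P m \<subseteq> P (Suc m))"
  using assms
proof (induction k arbitrary: i I)
  case 0
  then have "ideal (A i) R" "submonoid (M i) R" by auto
  moreover have "n \<oplus> a \<notin> I" if "n \<in> M i" "a \<in> A i" for n a
    using 0(3) that unfolding nested_values_0 by blast
  ultimately obtain Q where "primeideal Q R" "A i \<subseteq> Q" "I \<subseteq> Q" "Q \<inter> M i = {}"
    using prime_separation 0(2) by metis
  then show ?case by (intro exI[of _ "\<lambda>_. Q"]) auto
next
  case (Suc k)
  let ?T = "nested_values R M A (Suc i) k"
  let ?N = "{s \<otimes> t | s t. s \<in> M i \<and> t \<in> ?T}"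
  have Mi: "submonoid (M i) R" and Ai: "ideal (A i) R" using Suc.prems(1)[of i] by auto
  have T: "submonoid ?T R"
    by (rule nested_values_submonoid) (use Suc.prems in auto)
  interpret Mi: submonoid "M i" R by fact
  interpret T: submonoid ?T R by fact
  have "n \<oplus> a \<notin> I" if "n \<in> ?N" "a \<in> A i" for n a
    using Suc.prems(3) that unfolding nested_values_Suc by blast
  from prime_separation[OF Ai Suc.prems(2) submonoid_mult[OF Mi T] this]
  obtain Q where Q: "primeideal Q R" "A i \<subseteq> Q" "I \<subseteq> Q" "Q \<inter> ?N = {}"
    by blast
  \<comment> \<open>Setting one factor of \<open>?N\<close> to \<open>\<one>\<close> shows that
    \<open>Q\<close> avoids both \<open>M i\<close> and \<open>?T\<close>; the latter allows
    \<open>Q\<close> to serve as the ideal \<open>I\<close> of the next level.\<close>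
  have "s \<in> ?N" if "s \<in> M i" for s
    using that T.one_closed r_one[OF Mi.mem_carrier[OF that], symmetric] by blast
  then have QM: "M i \<inter> Q = {}" using Q(4) by blast
  have "t \<in> ?N" if "t \<in> ?T" for t
    using that Mi.one_closed l_one[OF T.mem_carrier[OF that], symmetric] by blast
  then have QT: "Q \<inter> ?T = {}" using Q(4) by blast
  have "\<exists>P. Q \<subseteq> P (Suc i) \<and>
    (\<forall>m\<in>{Suc i..Suc i+k}. primeideal (P m) R \<and> A m \<subseteq> P m \<and> M m \<inter> P m = {}) \<and>
    (\<forall>m\<in>{Suc i..<Suc i+k}. P m \<subseteq> P (Suc m))"
    by (rule Suc.IH) (use Suc.prems Q QT primeideal.axioms(1) in auto)
  then obtain P where P: "Q \<subseteq> P (Suc i)"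
    "\<forall>m\<in>{Suc i..Suc i+k}. primeideal (P m) R \<and> A m \<subseteq> P m \<and> M m \<inter> P m = {}"
    "\<forall>m\<in>{Suc i..<Suc i+k}. P m \<subseteq> P (Suc m)" by blast
  show ?case
  proof (intro exI[of _ "P(i := Q)"] conjI ballI)
    show "I \<subseteq> (P(i := Q)) i" using Q by simp
    show "(P(i := Q)) m \<subseteq> (P(i := Q)) (Suc m)" if "m \<in> {i..<i+Suc k}" for m
      using that P by (cases "m = i") auto
    fix m assume "m \<in> {i..i+Suc k}"
    then have "m = i \<or> m \<in> {Suc i..Suc i+k}" by auto
    then show "primeideal ((P(i := Q)) m) R" "A m \<subseteq> (P(i := Q)) m" "M m \<inter> (P(i := Q)) m = {}"
      using P Q QM by (cases "m = i"; auto)+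
  qed
qed

text \<open>From the innermost term outwards: a value outside \<open>P (Suc m)\<close> is outside
  the smaller \<open>P m\<close>, remains so after multiplication by \<open>u m\<close> because
  \<open>P m\<close> is prime, and after adding \<open>j m \<in> P m\<close>.\<close>

lemma (in cring) nested_notin_primes:
  assumes "\<And>m. m \<in> {i..i+k} \<Longrightarrow> primeideal (P m) R \<and> u m \<in> carrier R - P m \<and> j m \<in> P m"
    and "\<And>m. m \<in> {i..<i+k} \<Longrightarrow> P m \<subseteq> P (Suc m)"
  shows "nested R u j i k \<in> carrier R - P i"
  using assms
proof (induction k arbitrary: i)
  case 0
  then interpret Pi: primeideal "P i" R by simp
  have *: "u i \<in> carrier R" "u i \<notin> P i" "j i \<in> P i" "j i \<in> carrier R"
    using 0(1)[of i] Pi.Icarr by auto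
  have "u i = (u i \<oplus> j i) \<oplus> \<ominus> j i" using * by algebra
  then show ?case using * Pi.a_closed[of "u i \<oplus> j i" "\<ominus> j i"] by auto
next
  case (Suc k)
  then interpret Pi: primeideal "P i" R by simp
  let ?n = "nested R u j (Suc i) k"
  have "?n \<in> carrier R - P (Suc i)"
    by (rule Suc.IH) (use Suc.prems in auto)
  then have n: "?n \<in> carrier R" "?n \<notin> P i" using Suc.prems(2)[of i] by auto
  have *: "u i \<in> carrier R" "u i \<notin> P i" "j i \<in> P i" "j i \<in> carrier R"
    using Suc.prems(1)[of i] Pi.Icarr by auto
  have "u i \<otimes> ?n = (u i \<otimes> ?n \<oplus> j i) \<oplus> \<ominus> j i" using * n by algebra
  moreover have "u i \<otimes> ?n \<notin> P i" using Pi.I_prime * n by blast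
  ultimately show ?case using * n Pi.a_closed[of "u i \<otimes> ?n \<oplus> j i" "\<ominus> j i"] by auto
qed

section \<open>The formal Nullstellensatz\<close>

lemma (in ring) submonoid_genmonoid:
  assumes "U \<subseteq> carrier R" shows "submonoid (genmonoid R U) R"
proof
  have "submonoid (carrier R) R" by unfold_locales auto
  then show "genmonoid R U \<subseteq> carrier R" unfolding genmonoid_def using assms by blast
qed (auto simp: genmonoid_def intro: submonoid.m_closed submonoid.one_closed)

lemma genmonoid_self: "U \<subseteq> genmonoid R U"
  by (auto simp: genmonoid_def)

lemma genmonoid_minimal: "submonoid S R \<Longrightarrow> U \<subseteq> S \<Longrightarrow> genmonoid R U \<subseteq> S"
  by (auto simp: genmonoid_def)

lemma (in primeideal) submonoid_complement: "submonoid (carrier R - I) R"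
  using I_prime one_imp_carrier I_notcarr by unfold_locales auto

definition prime_chain ::
  "('a, 'b) ring_scheme \<Rightarrow> nat \<Rightarrow> 'a idealistic_chain \<Rightarrow> (nat \<Rightarrow> 'a set) \<Rightarrow> bool" where
  "prime_chain R l C P \<longleftrightarrow>
     (\<forall>i \<le> l. primeideal (P i) R \<and> chain_J C i \<subseteq> P i \<and> chain_U C i \<inter> P i = {}) \<and>
     (\<forall>i < l. P i \<subseteq> P (Suc i))"

lemma idealistic_chain_nth:
  assumes "idealistic_chain R l C" "i \<le> l"
  shows "chain_J C i \<subseteq> carrier R" "chain_U C i \<subseteq> carrier R"
  using assms by (auto simp: idealistic_chain_def idealistic_prime_def)

text \<open>Part (1), monotonicity of collapse and the description of the closure all use collapse
  through this equivalence. One direction holds because a nested value outside \<open>P 0\<close>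
  cannot be \<open>\<zero>\<close>, the other by building primes upwards.\<close>

theorem (in cring) collapses_iff_no_prime_chain:
  assumes C: "idealistic_chain R l C"
  shows "collapses R l C \<longleftrightarrow> \<not> (\<exists>P. prime_chain R l C P)"
proof
  assume "collapses R l C"
  then obtain u j where uj: "\<And>i. i \<le> l \<Longrightarrow> j i \<in> Idl (chain_J C i)"
    "\<And>i. i \<le> l \<Longrightarrow> u i \<in> genmonoid R (chain_U C i)" "nested R u j 0 l = \<zero>"
    unfolding collapses_def by blast
  show "\<not> (\<exists>P. prime_chain R l C P)"
  proof
    assume "\<exists>P. prime_chain R l C P"
    then obtain P where P: "prime_chain R l C P" ..
    then have prime: "primeideal (P i) R" if "i \<le> l" for i
      using that by (auto simp: prime_chain_def)
    have "nested R u j 0 l \<in> carrier R - P 0"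
    proof (rule nested_notin_primes)
      fix m assume "m \<in> {0..0+l}"
      then have m: "m \<le> l" by simp
      \<comment> \<open>The complement of a prime is a monoid, so avoiding the generators in
        \<open>U\<^sub>m\<close> suffices to avoid all of their products.\<close>
      have "genmonoid R (chain_U C m) \<subseteq> carrier R - P m"
        using P m idealistic_chain_nth[OF C m]
        by (intro genmonoid_minimal primeideal.submonoid_complement)
          (auto simp: prime_chain_def)
      moreover have "Idl (chain_J C m) \<subseteq> P m"
        using P m by (intro genideal_minimal) (auto simp: prime_chain_def primeideal.axioms(1))
      ultimately show "primeideal (P m) R \<and> u m \<in> carrier R - P m \<and> j m \<in> P m"
        using uj m prime by auto
    qed (use P in \<open>auto simp: prime_chain_def\<close>)
    moreover have "\<zero> \<in> P 0"
      using prime[of 0] by (simp add: additive_subgroup.zero_closed ideal.axioms(1) primeideal.axioms(1))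
    ultimately show False using uj by simp
  qed
next
  let ?A = "\<lambda>m. Idl (chain_J C m)" and ?M = "\<lambda>m. genmonoid R (chain_U C m)"
  assume *: "\<not> (\<exists>P. prime_chain R l C P)"
  show "collapses R l C"
  proof (rule ccontr)
    assume "\<not> collapses R l C"
    \<comment> \<open>Failure to collapse means that \<open>\<zero>\<close> is no nested value, so
      the choice of primes can start from the zero ideal.\<close>
    then have "{\<zero>} \<inter> nested_values R ?M ?A 0 l = {}"
      unfolding collapses_def nested_values_def by fastforce
    with prime_chain_exists[of 0 l ?A ?M "{\<zero>}"] obtain P where
      P: "\<forall>m\<in>{0..0+l}. primeideal (P m) R \<and> ?A m \<subseteq> P m \<and> ?M m \<inter> P m = {}"
      "\<forall>m\<in>{0..<0+l}. P m \<subseteq> P (Suc m)"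
      using idealistic_chain_nth[OF C] zeroideal genideal_ideal submonoid_genmonoid by auto
    have "prime_chain R l C P"
      unfolding prime_chain_def
    proof (intro conjI allI impI)
      fix i assume i: "i \<le> l"
      show "primeideal (P i) R" "chain_J C i \<subseteq> P i" "chain_U C i \<inter> P i = {}"
        using i P genideal_self[OF idealistic_chain_nth(1)[OF C i]]
          genmonoid_self[of "chain_U C i" R] by fastforce+
    qed (use P in auto)
    with * show False by blast
  qed
qed

section \<open>Adjoining an element to a chain, and monotonicity of collapse\<close>

lemma idealistic_chain_update:
  assumes "idealistic_chain R l C" "idealistic_prime R Q"
  shows "idealistic_chain R l (C[i := Q])"
  using assms set_update_subset_insert[of C i Q] by (auto simp: idealistic_chain_def)

lemma idealistic_chain_add:
  assumes "idealistic_chain R l C" "i \<le> l" "x \<in> carrier R"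
  shows "idealistic_chain R l (add_in C i x)" "idealistic_chain R l (add_notin C i x)"
  using assms idealistic_chain_nth[OF assms(1,2)]
  by (auto simp: add_in_def add_notin_def idealistic_prime_def intro!: idealistic_chain_update)

text \<open>Every prime chain of \<open>C\<close> survives in exactly one of the two extensions;
  part (1) rests on this dichotomy.\<close>

lemma prime_chain_add:
  assumes "idealistic_chain R l C" "i \<le> l"
  shows "prime_chain R l (add_in C i x) P \<longleftrightarrow> prime_chain R l C P \<and> x \<in> P i"
    and "prime_chain R l (add_notin C i x) P \<longleftrightarrow> prime_chain R l C P \<and> x \<notin> P i"
proof -
  have "i < length C" using assms by (auto simp: idealistic_chain_def)
  then have nth: "add_in C i x ! k = (if k = i then (chain_J C i \<union> {x}, chain_U C i) else C ! k)"
      "add_notin C i x ! k = (if k = i then (chain_J C i, chain_U C i \<union> {x}) else C ! k)" for k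
    by (auto simp: add_in_def add_notin_def)
  show "prime_chain R l (add_in C i x) P \<longleftrightarrow> prime_chain R l C P \<and> x \<in> P i"
    "prime_chain R l (add_notin C i x) P \<longleftrightarrow> prime_chain R l C P \<and> x \<notin> P i"
    unfolding prime_chain_def nth using assms(2) by auto
qed

text \<open>Refinement only tightens the conditions on a prime chain, so \<open>D\<close> has no
  prime chain if \<open>C\<close> has none.\<close>

lemma collapses_mono:
  assumes "idealistic_chain R l D" "cring R" "refines C D" "collapses R l C"
    "idealistic_chain R l C"
  shows "collapses R l D"
proof -
  interpret cring R by fact
  have "prime_chain R l C P" if "prime_chain R l D P" for P
  proof -
    have "chain_J C i \<subseteq> chain_J D i" "chain_U C i \<subseteq> chain_U D i" if "i \<le> l" for i
      using that assms(1,3) by (auto simp: refines_def idealistic_chain_def)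
    then show ?thesis using that unfolding prime_chain_def by blast
  qed
  then show ?thesis
    using assms collapses_iff_no_prime_chain by blast
qed

section \<open>Conjugate pairs cut out by primes, and the collapse closure\<close>

lemma conjugate_pairD:
  fixes R (structure)
  assumes "conjugate_pair R I S"
  shows "ideal I R" "submonoid S R"
    and "s \<in> S \<Longrightarrow> a \<in> carrier R \<Longrightarrow> s \<otimes> a \<in> I \<Longrightarrow> a \<in> I"
    and "a \<in> carrier R \<Longrightarrow> (n::nat) > 0 \<Longrightarrow> a [^] n \<in> I \<Longrightarrow> a \<in> I"
    and "j \<in> I \<Longrightarrow> s \<in> S \<Longrightarrow> s \<oplus> j \<in> S"
    and "s \<in> carrier R \<Longrightarrow> a \<in> carrier R \<Longrightarrow> s \<otimes> a \<in> S \<Longrightarrow> s \<in> S"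
  using assms unfolding conjugate_pair_def by blast+

text \<open>Each conjugacy condition holds for a single prime and its complement, and passes to
  intersections. The family \<open>F\<close> may be empty, and both sets are then the whole ring;
  this is the case of a collapsing chain.\<close>

lemma conjugate_pair_primes:
  fixes R (structure)
  assumes "cring R" and prime: "\<And>P. P \<in> F \<Longrightarrow> primeideal P R"
  shows "conjugate_pair R {x \<in> carrier R. \<forall>P\<in>F. x \<in> P} {x \<in> carrier R. \<forall>P\<in>F. x \<notin> P}"
    (is "conjugate_pair R ?I ?S")
proof -
  interpret cring R by fact
  have ideal: "ideal P R" if "P \<in> F" for P using prime[OF that] by (rule primeideal.axioms(1))
  \<comment> \<open>Inserting the carrier keeps the intersection inside the ring even for empty
    \<open>F\<close>.\<close>
  have "ideal (\<Inter>(insert (carrier R) F)) R"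
    using ideal oneideal by (intro i_Intersect) auto
  moreover have "\<Inter>(insert (carrier R) F) = ?I" by auto
  ultimately have I: "ideal ?I R" by simp
  have S: "submonoid ?S R"
  proof
    fix x y assume "x \<in> ?S" "y \<in> ?S"
    then have xy: "x \<in> carrier R" "y \<in> carrier R" "\<And>P. P \<in> F \<Longrightarrow> x \<notin> P \<and> y \<notin> P" by auto
    then have "x \<otimes> y \<notin> P" if "P \<in> F" for P
      using primeideal.I_prime[OF prime[OF that] xy(1,2)] that by blast
    then show "x \<otimes> y \<in> ?S" using xy by simp
  next
    show "\<one> \<in> ?S"
      using primeideal.submonoid_complement[OF prime] submonoid.one_closed by fastforce
  qed auto
  have div: "a \<in> ?I" if "s \<in> ?S" "a \<in> carrier R" "s \<otimes> a \<in> ?I" for s a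
    using that primeideal.I_prime[OF prime, of _ s a] by blast
  have pow_P: "a \<in> P" if "P \<in> F" "a \<in> carrier R" "a [^] n \<in> P" "n > 0" for a P and n :: nat
    using that(3,4)
  proof (induction n)
    case (Suc n)
    show ?case
    proof (cases "n = 0")
      case True
      then show ?thesis using Suc that by simp
    next
      case False
      then show ?thesis using Suc that primeideal.I_prime[OF prime[OF that(1)], of "a [^] n" a] by auto
    qed
  qed simp
  have pow: "a \<in> ?I" if "a \<in> carrier R" "n > 0" "a [^] n \<in> ?I" for a and n :: nat
    using that pow_P by blast
  have add: "s \<oplus> a \<in> ?S" if a: "a \<in> ?I" and s: "s \<in> ?S" for a s
  proof -
    have "s \<oplus> a \<notin> P" if P: "P \<in> F" for P
    proof
      interpret P: primeideal P R using prime[OF P] .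
      assume "s \<oplus> a \<in> P"
      moreover have "(s \<oplus> a) \<oplus> \<ominus> a = s" using a s by (simp add: a_assoc r_neg)
      ultimately have "s \<in> P" using a P P.a_closed[of "s \<oplus> a" "\<ominus> a"] by auto
      then show False using s P by auto
    qed
    then show ?thesis using a s by auto
  qed
  have fac: "s \<in> ?S" if "s \<in> carrier R" "t \<in> carrier R" "s \<otimes> t \<in> ?S" for s t
    using that ideal.I_r_closed[OF ideal, of _ s t] by blast
  show ?thesis
    unfolding conjugate_pair_def
  proof (intro conjI ballI allI impI)
    fix s a assume "s \<in> ?S" "a \<in> carrier R" "s \<otimes> a \<in> ?I"
    then show "a \<in> ?I" by (rule div)
  next
    fix a and n :: nat assume "a \<in> carrier R" "n > 0" "a [^] n \<in> ?I"
    then show "a \<in> ?I" by (rule pow)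
  next
    fix a s assume "a \<in> ?I" "s \<in> ?S"
    then show "s \<oplus> a \<in> ?S" by (rule add)
  next
    fix s t assume "s \<in> carrier R" "t \<in> carrier R" "s \<otimes> t \<in> ?S"
    then show "s \<in> ?S" by (rule fac)
  qed (fact I S)+
qed

lemma conjugate_pair_complete:
  fixes R (structure)
  assumes "cring R" "conjugate_pair R I S"
  shows "complete_prime R (I, S)"
proof -
  interpret cring R by fact
  have I: "ideal I R" and S: "submonoid S R" and add: "\<And>a s. a \<in> I \<Longrightarrow> s \<in> S \<Longrightarrow> s \<oplus> a \<in> S"
    using conjugate_pairD[OF assms(2)] by blast+
  interpret I: ideal I R by fact
  interpret S: submonoid S R by fact
  have "a \<oplus> s \<in> S" if "a \<in> I" "s \<in> S" for a s
    using add[OF that] that I.Icarr a_comm by simp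
  then have "I <+> S \<subseteq> S" unfolding set_add_def' by blast
  moreover have "S \<subseteq> I <+> S"
  proof
    fix s assume "s \<in> S"
    then have "s = \<zero> \<oplus> s" by simp
    then show "s \<in> I <+> S" using \<open>s \<in> S\<close> I.zero_closed unfolding set_add_def' by blast
  qed
  ultimately have "I <+> S = S" ..
  then show ?thesis using I S by (simp add: complete_prime_def)
qed

text \<open>By the Nullstellensatz, \<open>add_notin C i x\<close> collapses iff no prime chain of
  \<open>C\<close> has \<open>x \<notin> P i\<close>, and dually for \<open>add_in\<close>. The
  original members of \<open>J\<^sub>i\<close> and \<open>U\<^sub>i\<close> already satisfy the
  resulting conditions.\<close>

lemma collapse_closure_primes:
  fixes R (structure)
  assumes "cring R" and C: "idealistic_chain R l C" and i: "i \<le> l"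
  shows "collapse_closure R l C ! i =
    ({x \<in> carrier R. \<forall>P. prime_chain R l C P \<longrightarrow> x \<in> P i},
     {x \<in> carrier R. \<forall>P. prime_chain R l C P \<longrightarrow> x \<notin> P i})"
proof -
  interpret cring R by fact
  have "chain_J C i \<subseteq> P i" "chain_U C i \<inter> P i = {}" if "prime_chain R l C P" for P
    using that i by (auto simp: prime_chain_def)
  then show ?thesis
    using i idealistic_chain_nth[OF C i] idealistic_chain_add[OF C i] prime_chain_add[OF C i]
    by (auto simp: collapse_closure_def collapses_iff_no_prime_chain nth_append simp del: upt_Suc)
qed

text \<open>Conjugacy at level \<open>i\<close> comes from the family of all \<open>P i\<close>. The
  inclusions between levels come from \<open>P i \<subseteq> P (Suc i)\<close>, which reverses on
  complements.\<close>

lemma saturated_collapse_closure: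
  fixes R (structure)
  assumes R: "cring R" and C: "idealistic_chain R l C"
  shows "saturated_chain R l (collapse_closure R l C)" (is "saturated_chain R l ?D")
proof -
  note nth = collapse_closure_primes[OF R C]
  have len: "length ?D = Suc l" by (simp add: collapse_closure_def)
  have conj: "conjugate_pair R (chain_J ?D i) (chain_U ?D i)" if i: "i \<le> l" for i
  proof -
    let ?F = "(\<lambda>P. P i) ` {P. prime_chain R l C P}"
    have "primeideal Q R" if "Q \<in> ?F" for Q
      using that i by (auto simp: prime_chain_def)
    from conjugate_pair_primes[of R ?F, OF R this] show ?thesis by (simp add: nth[OF i])
  qed
  have "complete_prime R (?D ! i)" if "i \<le> l" for i
    using conjugate_pair_complete[OF R conj[OF that]] by simp
  moreover have "idealistic_chain R l ?D"
    using len by (auto simp: idealistic_chain_def idealistic_prime_def in_set_conv_nth nth less_Suc_eq_le)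
  moreover have "chain_J ?D i \<subseteq> chain_J ?D (Suc i) \<and> chain_U ?D (Suc i) \<subseteq> chain_U ?D i"
    if "i < l" for i
  proof -
    have "P i \<subseteq> P (Suc i)" if "prime_chain R l C P" for P
      using that \<open>i < l\<close> by (simp add: prime_chain_def)
    then show ?thesis using that by (auto simp: nth)
  qed
  ultimately show ?thesis
    using conj by (auto simp: saturated_chain_def complete_chain_def)
qed

section \<open>Collapse identities in saturated chains\<close>

lemma complete_chainD:
  assumes "complete_chain R l D" "i \<le> l"
  shows "ideal (chain_J D i) R" "submonoid (chain_U D i) R"
    "i < l \<Longrightarrow> chain_J D i \<subseteq> chain_J D (Suc i)" "i < l \<Longrightarrow> chain_U D (Suc i) \<subseteq> chain_U D i"
  using assms by (auto simp: complete_chain_def complete_prime_def)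

text \<open>From the innermost term outwards:
  \<open>U\<^sub>m\<^sub>+\<^sub>1 \<subseteq> U\<^sub>m\<close> permits multiplication by
  \<open>u m\<close> inside \<open>U\<^sub>m\<close>, and conjugacy permits adding
  \<open>j m\<close>.\<close>

lemma (in cring) nested_in_U:
  assumes D: "saturated_chain R l D" and "i + k = l"
    and "\<And>m. m \<in> {i..i+k} \<Longrightarrow> u m \<in> chain_U D m \<and> j m \<in> chain_J D m"
  shows "nested R u j i k \<in> chain_U D i"
  using assms(2,3)
proof (induction k arbitrary: i)
  case 0
  then show ?case using D by (auto simp: saturated_chain_def conjugate_pair_def)
next
  case (Suc k)
  have "nested R u j (Suc i) k \<in> chain_U D (Suc i)"
    by (rule Suc.IH) (use Suc.prems in auto)
  moreover have "complete_chain R l D" using D by (simp add: saturated_chain_def)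
  ultimately have "u i \<otimes> nested R u j (Suc i) k \<in> chain_U D i"
    using complete_chainD[of R l D i] Suc.prems submonoid.m_closed[of "chain_U D i" R] by auto
  then show ?case
    using D Suc.prems by (auto simp: saturated_chain_def conjugate_pair_def)
qed

lemma (in cring) nested_closed:
  assumes "\<And>m. m \<in> {i..i+k} \<Longrightarrow> u m \<in> carrier R \<and> j m \<in> carrier R"
  shows "nested R u j i k \<in> carrier R"
  using assms
proof (induction k arbitrary: i)
  case (Suc k)
  have "nested R u j (Suc i) k \<in> carrier R"
    by (rule Suc.IH) (use Suc.prems in auto)
  then show ?case using Suc.prems[of i] by simp
qed simp

text \<open>
  The part of the collapse identity beyond \<open>i\<close> is an element of \<open>U\<^sub>i\<close>, and the part before \<open>i\<close>
  can be cancelled because \<open>J\<^sub>m\<close> and \<open>U\<^sub>m\<close> are conjugate.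
\<close>

lemma (in cring) collapse_localize:
  assumes D: "saturated_chain R l D" and i: "i \<le> l"
    and E: "idealistic_chain R l E" "\<And>m. m \<le> l \<Longrightarrow> m \<noteq> i \<Longrightarrow> E ! m = D ! m"
    and coll: "collapses R l E"
  obtains u s a where "u \<in> genmonoid R (chain_U E i)" "s \<in> chain_U D i" "a \<in> Idl (chain_J E i)"
    "u \<otimes> s \<oplus> a \<in> chain_J D i"
proof -
  have compl: "complete_chain R l D"
    and conj: "\<And>m. m \<le> l \<Longrightarrow> conjugate_pair R (chain_J D m) (chain_U D m)"
    using D by (auto simp: saturated_chain_def)
  note cD = complete_chainD[OF compl]
  from coll obtain u j where uj: "\<And>m. m \<le> l \<Longrightarrow> j m \<in> Idl (chain_J E m)"
    "\<And>m. m \<le> l \<Longrightarrow> u m \<in> genmonoid R (chain_U E m)" and zero: "nested R u j 0 l = \<zero>"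
    unfolding collapses_def by blast
  have off: "u m \<in> chain_U D m \<and> j m \<in> chain_J D m" if "m \<le> l" "m \<noteq> i" for m
    using uj[OF that(1)] genmonoid_minimal[OF cD(2)[OF that(1)]] genideal_minimal[OF cD(1)[OF that(1)]]
    by (auto simp: E(2)[OF that])
  have carr: "u m \<in> carrier R \<and> j m \<in> carrier R" if "m \<le> l" for m
    using uj[OF that] idealistic_chain_nth[OF E(1) that] submonoid.subset[OF submonoid_genmonoid]
      ideal.Icarr[OF genideal_ideal] by blast
  \<comment> \<open>Starting from the total value \<open>\<zero>\<close>, each level below
    \<open>i\<close> is stripped: subtract \<open>j m\<close>, cancel \<open>u m\<close> by
    conjugacy, then pass from \<open>J\<^sub>m\<close> to \<open>J\<^sub>m\<^sub>+\<^sub>1\<close>.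
    This stops at \<open>i\<close>, where \<open>E\<close> may differ from \<open>D\<close>.\<close>
  have head: "m \<le> i \<Longrightarrow> nested R u j m (l - m) \<in> chain_J D m" for m
  proof (induction m)
    case 0
    then show ?case
      using zero cD(1)[of 0] by (simp add: additive_subgroup.zero_closed ideal.axioms(1))
  next
    case (Suc m)
    then have m: "m < l" "m \<le> l" "m \<noteq> i" using i by auto
    interpret J: ideal "chain_J D m" R using cD(1)[OF m(2)] .
    let ?n = "nested R u j (Suc m) (l - Suc m)"
    have n: "?n \<in> carrier R"
      by (rule nested_closed) (use carr m in auto)
    have "l - m = Suc (l - Suc m)" using m by simp
    then have "u m \<otimes> ?n \<oplus> j m \<in> chain_J D m" using Suc by simp
    moreover have "u m \<otimes> ?n = (u m \<otimes> ?n \<oplus> j m) \<oplus> \<ominus> j m"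
      using n carr[OF m(2)] by algebra
    ultimately have "u m \<otimes> ?n \<in> chain_J D m"
      using off[OF m(2,3)] J.a_closed[of "u m \<otimes> ?n \<oplus> j m" "\<ominus> j m"] by simp
    then have "?n \<in> chain_J D m"
      using conjugate_pairD(3)[OF conj[OF m(2)]] off[OF m(2,3)] n by blast
    then show ?case using cD(3)[OF m(2,1)] by blast
  qed
  have "\<exists>s \<in> chain_U D i. nested R u j i (l - i) = u i \<otimes> s \<oplus> j i"
  proof (cases "i = l")
    \<comment> \<open>At the last level there is no inner expression, and \<open>\<one>\<close>
      takes its place.\<close>
    case True
    then show ?thesis
      using carr[OF i] submonoid.one_closed[OF cD(2)[OF i]] by (intro bexI[of _ \<one>]) auto
  next
    case False
    then have il: "i < l" using i by simp
    have "nested R u j (Suc i) (l - Suc i) \<in> chain_U D (Suc i)"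
      by (rule nested_in_U[OF D]) (use il off in auto)
    moreover have "l - i = Suc (l - Suc i)" using il by simp
    ultimately show ?thesis using cD(4)[OF i il] by auto
  qed
  with head[of i] uj[OF i] that show thesis by auto
qed

text \<open>Localizing gives \<open>(t \<otimes> s) \<otimes> x [^] n \<in> J\<^sub>i\<close> with
  \<open>t\<close> and \<open>s\<close> in \<open>U\<^sub>i\<close>. Conjugacy cancels
  \<open>t \<otimes> s\<close> and then extracts the root.\<close>

lemma (in cring) saturated_mem_J:
  assumes D: "saturated_chain R l D" and i: "i \<le> l" and x: "x \<in> carrier R"
    and coll: "collapses R l (add_notin D i x)"
  shows "x \<in> chain_J D i"
proof -
  let ?J = "chain_J D i" and ?U = "chain_U D i"
  have D': "idealistic_chain R l D" and conj: "conjugate_pair R ?J ?U"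
    using D i by (auto simp: saturated_chain_def complete_chain_def)
  have len: "i < length D" using D' i by (simp add: idealistic_chain_def)
  note J = conjugate_pairD(1)[OF conj] and U = conjugate_pairD(2)[OF conj]
  interpret J: ideal ?J R by fact
  interpret U: submonoid ?U R by fact
  obtain u s a where usa: "u \<in> genmonoid R (?U \<union> {x})" "s \<in> ?U" "a \<in> Idl ?J" "u \<otimes> s \<oplus> a \<in> ?J"
    using collapse_localize[OF D i idealistic_chain_add(2)[OF D' i x] _ coll] len
    by (auto simp: add_notin_def)
  let ?P = "{y. \<exists>n::nat. y = x [^] n}"
  have P: "submonoid ?P R"
  proof
    show "\<one> \<in> ?P" by (auto intro: exI[of _ "0::nat"])
  qed (use x nat_pow_mult in auto)
  have "genmonoid R (?U \<union> {x}) \<subseteq> {t \<otimes> y | t y. t \<in> ?U \<and> y \<in> ?P}"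
  proof (rule genmonoid_minimal[OF submonoid_mult[OF U P]], rule subsetI)
    fix y assume "y \<in> ?U \<union> {x}"
    moreover have "y = y \<otimes> x [^] (0::nat)" if "y \<in> ?U" using that by simp
    moreover have "x = \<one> \<otimes> x [^] (1::nat)" using x by simp
    ultimately show "y \<in> {t \<otimes> y | t y. t \<in> ?U \<and> y \<in> ?P}" using U.one_closed by blast
  qed
  with usa(1) obtain t and n :: nat where tn: "t \<in> ?U" "u = t \<otimes> x [^] n" by blast
  have a: "a \<in> ?J" using usa(3) genideal_minimal[OF J] by blast
  have c: "t \<in> carrier R" "s \<in> carrier R" "a \<in> carrier R" "x [^] n \<in> carrier R"
    using tn usa(2) a J.Icarr x by auto
  have "(t \<otimes> s) \<otimes> x [^] n = (u \<otimes> s \<oplus> a) \<oplus> \<ominus> a"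
    unfolding tn using c by algebra
  also have "\<dots> \<in> ?J" using usa(4) a by simp
  finally have "x [^] n \<in> ?J"
    using conjugate_pairD(3)[OF conj U.m_closed[OF tn(1) usa(2)]] c by blast
  \<comment> \<open>The exponent \<open>n\<close> may be zero, while the radical condition requires
    a positive one.\<close>
  moreover have "x [^] (Suc n) = x [^] n \<otimes> x" by simp
  ultimately have "x [^] (Suc n) \<in> ?J" using J.I_r_closed x by simp
  then show ?thesis using conjugate_pairD(4)[OF conj x] by blast
qed

text \<open>Localizing gives \<open>u \<otimes> s \<oplus> b \<oplus> r \<otimes> x \<in>
  J\<^sub>i\<close>. Hence a multiple of \<open>x\<close> lies in \<open>U\<^sub>i\<close>, and so
  does its factor \<open>x\<close>.\<close>

lemma (in cring) saturated_mem_U: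
  assumes D: "saturated_chain R l D" and i: "i \<le> l" and x: "x \<in> carrier R"
    and coll: "collapses R l (add_in D i x)"
  shows "x \<in> chain_U D i"
proof -
  let ?J = "chain_J D i" and ?U = "chain_U D i"
  have D': "idealistic_chain R l D" and conj: "conjugate_pair R ?J ?U"
    using D i by (auto simp: saturated_chain_def complete_chain_def)
  have len: "i < length D" using D' i by (simp add: idealistic_chain_def)
  note J = conjugate_pairD(1)[OF conj] and U = conjugate_pairD(2)[OF conj]
  interpret J: ideal ?J R by fact
  interpret U: submonoid ?U R by fact
  obtain u s a where usa: "u \<in> genmonoid R ?U" "s \<in> ?U" "a \<in> Idl (?J \<union> {x})" "u \<otimes> s \<oplus> a \<in> ?J"
    using collapse_localize[OF D i idealistic_chain_add(1)[OF D' i x] _ coll] len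
    by (auto simp: add_in_def)
  have u: "u \<in> ?U" using usa(1) genmonoid_minimal[OF U] by blast
  have "Idl (?J \<union> {x}) \<subseteq> ?J <+> PIdl x"
    using ideal_sum_memI[OF J cgenideal_ideal[OF x]] cgenideal_self[OF x]
    by (intro genideal_minimal add_ideals J cgenideal_ideal x) auto
  with usa(3) obtain b r where br: "b \<in> ?J" "r \<in> carrier R" "a = b \<oplus> r \<otimes> x"
    by (auto simp: set_add_def' cgenideal_def)
  let ?d = "u \<otimes> s \<oplus> a"
  have c: "u \<in> carrier R" "s \<in> carrier R" "b \<in> carrier R" using u usa(2) br(1) J.Icarr by auto
  \<comment> \<open>Translating \<open>u \<otimes> s \<in> ?U\<close> by an element of
    \<open>?J\<close> keeps it in \<open>?U\<close>; this translation is chosen so that only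
    \<open>x \<otimes> \<ominus> r\<close> remains.\<close>
  have "u \<otimes> s \<oplus> (b \<oplus> \<ominus> ?d) \<in> ?U"
    using u usa(2,4) br(1) by (intro conjugate_pairD(5)[OF conj]) auto
  moreover have "u \<otimes> s \<oplus> (b \<oplus> \<ominus> ?d) = x \<otimes> \<ominus> r"
    unfolding br using c br(2) x by algebra
  ultimately show ?thesis using conjugate_pairD(6)[OF conj x, of "\<ominus> r"] br(2) by simp
qed

section \<open>Minimality of the closure and the conclusion\<close>

lemma refines_add:
  assumes "refines C D" "i < length C"
  shows "refines (add_in C i x) (add_in D i x)" "refines (add_notin C i x) (add_notin D i x)"
  using assms by (auto simp: refines_def add_in_def add_notin_def nth_list_update)

theorem theorem1p10:
  fixes R :: "('a, 'b) ring_scheme" (structure)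
    and l :: nat
    and C :: "'a idealistic_chain"
  assumes "cring R"
    and "idealistic_chain R l C"
  shows "(\<forall>x \<in> carrier R. \<forall>i \<le> l.
            collapses R l (add_in C i x) \<and> collapses R l (add_notin C i x) \<longrightarrow>
            collapses R l C) \<and>
         least_saturated_refinement R l C (collapse_closure R l C)"
proof -
  interpret cring R by fact
  note C = assms(2)
  have len: "length C = Suc l" using C by (simp add: idealistic_chain_def)
  have len_closure: "length (collapse_closure R l C) = Suc l"
    by (simp add: collapse_closure_def)
  have nth: "collapse_closure R l C ! i =
      (chain_J C i \<union> {x \<in> carrier R. collapses R l (add_notin C i x)},
       chain_U C i \<union> {x \<in> carrier R. collapses R l (add_in C i x)})" if "i \<le> l" for i
    using that by (simp add: collapse_closure_def nth_append)
  \<comment> \<open>A prime chain of \<open>C\<close> would be one of \<open>add_in C i x\<close> or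
    of \<open>add_notin C i x\<close>, according to whether \<open>x \<in> P i\<close>.\<close>
  have "collapses R l C"
    if "x \<in> carrier R" "i \<le> l" "collapses R l (add_in C i x)" "collapses R l (add_notin C i x)"
    for x i
    using that C idealistic_chain_add[OF C] prime_chain_add[OF C] collapses_iff_no_prime_chain
    by metis
  moreover have "refines C (collapse_closure R l C)"
    using len len_closure by (auto simp: refines_def less_Suc_eq_le nth)
  moreover have "refines (collapse_closure R l C) D"
    if D: "saturated_chain R l D" and CD: "refines C D" for D
  proof -
    have D': "idealistic_chain R l D"
      using D by (simp add: saturated_chain_def complete_chain_def)
    have "chain_J (collapse_closure R l C) i \<subseteq> chain_J D i \<and>
        chain_U (collapse_closure R l C) i \<subseteq> chain_U D i" if i: "i \<le> l" for i
    proof -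
      \<comment> \<open>Monotonicity carries the collapse from the extension of \<open>C\<close> to
        that of \<open>D\<close>, and a saturated \<open>D\<close> already contains such an
        \<open>x\<close>.\<close>
      have "collapses R l (add_notin D i x)" "x \<in> carrier R"
        if "x \<in> carrier R" "collapses R l (add_notin C i x)" for x
        using that collapses_mono idealistic_chain_add[OF D' i] idealistic_chain_add[OF C i]
          refines_add[OF CD] i len assms(1) by (metis less_Suc_eq_le)+
      moreover have "collapses R l (add_in D i x)"
        if "x \<in> carrier R" "collapses R l (add_in C i x)" for x
        using that collapses_mono idealistic_chain_add[OF D' i] idealistic_chain_add[OF C i]
          refines_add[OF CD] i len assms(1) by (metis less_Suc_eq_le)
      ultimately show ?thesis
        using CD i len saturated_mem_J[OF D i] saturated_mem_U[OF D i]
        by (auto simp: nth refines_def less_Suc_eq_le)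
    qed
    then show ?thesis
      using CD len len_closure by (simp add: refines_def less_Suc_eq_le)
  qed
  ultimately show ?thesis
    using saturated_collapse_closure[OF assms]
    unfolding least_saturated_refinement_def by blast
qed

end
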